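(* Let $L_1=\{(t,\tfrac12,0):0\le t\le1\}$, $L_2=\{(0,t,\tfrac12):0\le t\le1\}$, $L_3=\{(\tfrac12,0,t):0\le t\le1\}$, viewed as subsets of $\mathbb{T}^3=\mathbb{R}^3/\mathbb{Z}^3$. Let $H(y,p)=\frac12|p|^2+V(y)$, where $V\in C^\infty(\mathbb{T}^3)$ satisfies $\max_{\mathbb{T}^3}V=0$ and $\{V=0\}=L_1\cup L_2\cup L_3$. Then there is no way to select, for each $p\in\mathbb{R}^3$, a viscosity solution $v(\cdot,p)\in\mathrm{Lip}(\mathbb{T}^3)$ of the cell problem $$H(y,p+Dv(y,p))=\overline H(p)\quad\text{in }\mathbb{T}^3$$ such that $p\mapsto v(y,p)$ is continuous at $p=0$ (for every $y\in\mathbb{T}^3$).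
   Context: For each $p\in\mathbb{R}^3$, $\overline H(p)$ is the unique constant for which the cell problem $H(y,p+Dv)=\overline H(p)$ in $\mathbb{T}^3$ has a continuous viscosity solution $v$. Solutions $v$ are in general not unique even up to additive constants. $\mathrm{Lip}(\mathbb{T}^3)$ is the set of Lipschitz continuous functions on $\mathbb{T}^3$. *)

theory Defs
  imports "HOL-Analysis.Analysis"
begin

text \<open>Functions on the torus are represented by their lattice-periodic lifts, and subsets of the
  torus by their full preimages under the projection.\<close>

definition integer_lattice :: "(real ^ 'n) set" where
  "integer_lattice = {k. \<forall>i. k $ i \<in> \<int>}"

definition lattice_periodic :: "(real ^ 'n \<Rightarrow> 'b) \<Rightarrow> bool" where
  "lattice_periodic f \<longleftrightarrow> (\<forall>x. \<forall>k\<in>integer_lattice. f (x + k) = f x)"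

definition torus_preimage :: "(real ^ 'n) set \<Rightarrow> (real ^ 'n) set" where
  "torus_preimage A = {a + k | a k. a \<in> A \<and> k \<in> integer_lattice}"

fun C_k :: "nat \<Rightarrow> ('a::euclidean_space \<Rightarrow> real) \<Rightarrow> bool" where
  "C_k 0 f \<longleftrightarrow> continuous_on UNIV f"
| "C_k (Suc k) f \<longleftrightarrow>
     (\<forall>x. f differentiable (at x)) \<and>
     (\<forall>b\<in>Basis. C_k k (\<lambda>x. frechet_derivative f (at x) b))"

definition C_infinity :: "('a::euclidean_space \<Rightarrow> real) \<Rightarrow> bool" where
  "C_infinity f \<longleftrightarrow> (\<forall>k. C_k k f)"

text \<open>Viscosity subsolutions, supersolutions and solutions of \<open>F (y, Du(y)) = c\<close> on the whole
  space, with \<open>C\<^sup>1\<close> test functions touching locally. Touching is a local condition, so for a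
  periodic \<open>u\<close> and an \<open>F\<close> periodic in \<open>y\<close> this is the notion on the torus.\<close>

definition viscosity_subsolution ::
    "('a::euclidean_space \<Rightarrow> 'a \<Rightarrow> real) \<Rightarrow> real \<Rightarrow> ('a \<Rightarrow> real) \<Rightarrow> bool" where
  "viscosity_subsolution F c u \<longleftrightarrow> continuous_on UNIV u \<and>
     (\<forall>\<phi> y q. C_k 1 \<phi> \<longrightarrow> GDERIV \<phi> y :> q \<longrightarrow>
        (\<forall>\<^sub>F x in nhds y. u x - \<phi> x \<le> u y - \<phi> y) \<longrightarrow> F y q \<le> c)"

definition viscosity_supersolution ::
    "('a::euclidean_space \<Rightarrow> 'a \<Rightarrow> real) \<Rightarrow> real \<Rightarrow> ('a \<Rightarrow> real) \<Rightarrow> bool" where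
  "viscosity_supersolution F c u \<longleftrightarrow> continuous_on UNIV u \<and>
     (\<forall>\<phi> y q. C_k 1 \<phi> \<longrightarrow> GDERIV \<phi> y :> q \<longrightarrow>
        (\<forall>\<^sub>F x in nhds y. u x - \<phi> x \<ge> u y - \<phi> y) \<longrightarrow> F y q \<ge> c)"

definition viscosity_solution ::
    "('a::euclidean_space \<Rightarrow> 'a \<Rightarrow> real) \<Rightarrow> real \<Rightarrow> ('a \<Rightarrow> real) \<Rightarrow> bool" where
  "viscosity_solution F c u \<longleftrightarrow> viscosity_subsolution F c u \<and> viscosity_supersolution F c u"

definition cell_solution ::
    "(real ^ 'n \<Rightarrow> real ^ 'n \<Rightarrow> real) \<Rightarrow> real ^ 'n \<Rightarrow> real \<Rightarrow> (real ^ 'n \<Rightarrow> real) \<Rightarrow> bool" where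
  "cell_solution H p c v \<longleftrightarrow>
     lattice_periodic v \<and> viscosity_solution (\<lambda>y q. H y (p + q)) c v"

definition effective_hamiltonian ::
    "(real ^ 'n \<Rightarrow> real ^ 'n \<Rightarrow> real) \<Rightarrow> real ^ 'n \<Rightarrow> real" where
  "effective_hamiltonian H p = (THE c. \<exists>v. cell_solution H p c v)"

definition mechanical_hamiltonian ::
    "(real ^ 'n \<Rightarrow> real) \<Rightarrow> real ^ 'n \<Rightarrow> real ^ 'n \<Rightarrow> real" where
  "mechanical_hamiltonian V y p = 1 / 2 * (norm p)\<^sup>2 + V y"

definition L1 :: "(real ^ 3) set" where
  "L1 = {vector [t, 1 / 2, 0] | t. 0 \<le> t \<and> t \<le> 1}"

definition L2 :: "(real ^ 3) set" where
  "L2 = {vector [0, t, 1 / 2] | t. 0 \<le> t \<and> t \<le> 1}"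

definition L3 :: "(real ^ 3) set" where
  "L3 = {vector [1 / 2, 0, t] | t. 0 \<le> t \<and> t \<le> 1}"

end

theory Submission
  imports Defs
begin

text \<open>For the momentum \<open>p = \<epsilon> e\<^sub>i\<close> with small \<open>\<epsilon> > 0\<close> the level of the cell problem is \<open>\<epsilon>\<^sup>2 / 2\<close>, attained
  only on the line \<open>L\<^sub>i\<close>: a periodic \<open>C\<^sup>1\<close> barrier \<open>\<phi>\<close> satisfies \<open>H (y, p + D\<phi>) < \<epsilon>\<^sup>2 / 2\<close> off \<open>L\<^sub>i\<close>, and \<open>\<phi>\<close>
  exceeds its value on \<open>L\<^sub>i\<close> by a fixed \<open>\<eta> > 0\<close>, independent of \<open>\<epsilon>\<close>, at a point of each other line. For a
  solution \<open>v\<close>, the minimum of \<open>v - \<phi>\<close> must therefore lie on \<open>L\<^sub>i\<close>, where \<open>v\<close> is constant because it is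
  nonincreasing and periodic along the line. Hence \<open>v\<close> is larger by at least \<open>\<eta>\<close> at some point of \<open>L\<^sub>j\<close> than
  on \<open>L\<^sub>i\<close>. Letting \<open>\<epsilon>\<close> tend to \<open>0\<close> along two different axes gives contradictory inequalities for \<open>v (\<cdot>, 0)\<close>.\<close>

section \<open>Smooth steps and periodic functions\<close>

lemma C_1_I:
  fixes f :: "'a::euclidean_space \<Rightarrow> real"
  assumes f: "\<And>x. GDERIV f x :> g x" and g: "continuous_on UNIV g"
  shows "C_k 1 f"
proof -
  have D: "(f has_derivative (\<lambda>h. h \<bullet> g x)) (at x)" for x
    using f by (simp add: gderiv_def)
  have "frechet_derivative f (at x) = (\<lambda>h. h \<bullet> g x)" for x
    using frechet_derivative_at[OF D] by simp
  then show ?thesis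
    using D g by (auto simp: differentiable_def intro!: continuous_intros)
qed

lemma GDERIV_imp_continuous_on:
  assumes "\<And>x. GDERIV f x :> g x"
  shows "continuous_on A f"
  using assms unfolding gderiv_def
  by (intro has_derivative_continuous_on) (rule has_derivative_at_withinI)

text \<open>The first-order Taylor error is at most \<open>(y - x)\<^sup>2\<close>, also when
  \<open>x\<close> and \<open>y\<close> lie on different sides of the kink at 0.\<close>

lemma has_real_derivative_max_0_squared:
  "((\<lambda>x. (max 0 x)\<^sup>2) has_real_derivative 2 * max 0 x) (at x)"
proof -
  let ?f = "\<lambda>x::real. (max 0 x)\<^sup>2"
  have est: "\<bar>?f y - ?f x - 2 * max 0 x * (y - x)\<bar> \<le> (y - x)\<^sup>2" for y
  proof (cases "x \<le> 0")
    case True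
    show ?thesis
    proof (cases "y \<le> 0")
      case False
      then have "y\<^sup>2 \<le> (y - x)\<^sup>2" using True by (intro power_mono) auto
      then show ?thesis using True False by (simp add: max_def)
    qed (use True in simp)
  next
    case x: False
    show ?thesis
    proof (cases "y \<le> 0")
      case True
      have "?f y - ?f x - 2 * max 0 x * (y - x) = x * (x - 2 * y)"
        using x True by (simp add: max_def algebra_simps power2_eq_square)
      moreover have "0 \<le> x * (x - 2 * y)" using x True by simp
      moreover have "x * (x - 2 * y) \<le> (y - x)\<^sup>2"
        by (simp add: algebra_simps power2_eq_square)
      ultimately show ?thesis by simp
    next
      case False
      then have "?f y - ?f x - 2 * max 0 x * (y - x) = (y - x)\<^sup>2"
        using x by (simp add: max_def algebra_simps power2_eq_square)
      then show ?thesis by simp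
    qed
  qed
  have "((\<lambda>y. (?f y - ?f x) / (y - x) - 2 * max 0 x) \<longlongrightarrow> 0) (at x)"
  proof (rule Lim_null_comparison)
    show "\<forall>\<^sub>F y in at x. norm ((?f y - ?f x) / (y - x) - 2 * max 0 x) \<le> \<bar>y - x\<bar>"
    proof (rule eventually_mono[OF eventually_neq_at_within[of x]])
      fix y assume "y \<noteq> x"
      then have "(?f y - ?f x) / (y - x) - 2 * max 0 x
          = (?f y - ?f x - 2 * max 0 x * (y - x)) / (y - x)"
        by (simp add: field_simps)
      also have "\<bar>\<dots>\<bar> \<le> (y - x)\<^sup>2 / \<bar>y - x\<bar>"
        unfolding abs_divide by (intro divide_right_mono est) simp
      also have "\<dots> = \<bar>y - x\<bar>"
        by (metis abs_mult_self_eq nonzero_mult_div_cancel_left power2_eq_square div_by_0 mult_eq_0_iff)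
      finally show "norm ((?f y - ?f x) / (y - x) - 2 * max 0 x) \<le> \<bar>y - x\<bar>" by simp
    qed
    show "((\<lambda>y. \<bar>y - x\<bar>) \<longlongrightarrow> 0) (at x)"
      by (auto intro!: tendsto_eq_intros)
  qed
  then show ?thesis
    unfolding has_field_derivative_iff by (simp add: LIM_zero_iff)
qed

text \<open>The antiderivative of the hat function on [0, 2] with peak 1 at 1; it is C^1, which is
  all that a test function has to be.\<close>

definition smooth_step :: "real \<Rightarrow> real" where
  "smooth_step x = ((max 0 x)\<^sup>2 - 2 * (max 0 (x - 1))\<^sup>2 + (max 0 (x - 2))\<^sup>2) / 2"

definition smooth_step_deriv :: "real \<Rightarrow> real" where
  "smooth_step_deriv x = max 0 x - 2 * max 0 (x - 1) + max 0 (x - 2)"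

lemma has_real_derivative_smooth_step:
  "(smooth_step has_real_derivative smooth_step_deriv x) (at x)"
proof -
  have "((\<lambda>x. x - a) has_real_derivative 1) (at x)" for a :: real
    by (auto intro!: derivative_eq_intros)
  from DERIV_chain2[where f = "\<lambda>x. (max 0 x)\<^sup>2", OF has_real_derivative_max_0_squared this]
  have shift: "((\<lambda>x. (max 0 (x - a))\<^sup>2) has_real_derivative 2 * max 0 (x - a)) (at x)" for a :: real
    by simp
  show ?thesis
    unfolding smooth_step_def[abs_def] smooth_step_deriv_def
    by (rule derivative_eq_intros has_real_derivative_max_0_squared shift refl | simp)+
qed

lemma continuous_on_smooth_step_deriv: "continuous_on A smooth_step_deriv"
  unfolding smooth_step_deriv_def[abs_def] by (intro continuous_intros)

lemma smooth_step_deriv_bounds: "\<bar>smooth_step_deriv x\<bar> \<le> 1"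
  by (auto simp: smooth_step_deriv_def max_def)

lemma smooth_step_bounds: "0 \<le> smooth_step x \<and> smooth_step x \<le> 1"
proof -
  consider "x \<le> 0" | "0 < x" "x \<le> 1" | "1 < x" "x \<le> 2" | "2 < x" by linarith
  then show ?thesis
  proof cases
    case 2
    then have "x\<^sup>2 \<le> 1" by (simp add: power_le_one)
    then show ?thesis using 2 by (simp add: smooth_step_def)
  next
    case 3
    have "smooth_step x = 1 - (2 - x)\<^sup>2 / 2"
      using 3 by (simp add: smooth_step_def power2_eq_square field_simps)
    moreover have "(2 - x)\<^sup>2 \<le> 1" using 3 by (simp add: power_le_one)
    ultimately show ?thesis by simp
  next
    case 4
    then show ?thesis by (simp add: smooth_step_def power2_eq_square algebra_simps)
  qed (simp add: smooth_step_def)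
qed

lemma smooth_step_flat:
  "x \<le> 0 \<Longrightarrow> smooth_step x = 0" "x \<ge> 2 \<Longrightarrow> smooth_step x = 1"
  "x \<le> 0 \<Longrightarrow> smooth_step_deriv x = 0" "x \<ge> 2 \<Longrightarrow> smooth_step_deriv x = 0"
  by (auto simp: smooth_step_def smooth_step_deriv_def max_def power2_eq_square field_simps)

text \<open>Taking fractional parts moves every point into the compact unit cube by a lattice
  translation.\<close>

lemma periodic_attains_inf:
  fixes f :: "real ^ 'n \<Rightarrow> real"
  assumes per: "lattice_periodic f" and cont: "continuous_on UNIV f"
  obtains y where "\<And>x. f y \<le> f x"
proof -
  define F :: "real ^ 'n \<Rightarrow> real ^ 'n" where "F x = (\<chi> i. frac (x $ i))" for x
  have red: "f (F x) = f x" for x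
  proof -
    have "(\<chi> i. - of_int \<lfloor>x $ i\<rfloor>) \<in> (integer_lattice :: (real ^ 'n) set)"
      by (simp add: integer_lattice_def)
    moreover have "F x = x + (\<chi> i. - of_int \<lfloor>x $ i\<rfloor>)"
      by (simp add: F_def frac_def vec_eq_iff)
    ultimately show ?thesis using per by (simp add: lattice_periodic_def)
  qed
  have box: "F x \<in> cbox 0 1" for x
    by (simp add: F_def mem_box_cart less_imp_le[OF frac_lt_1])
  obtain y where "y \<in> cbox 0 1" "\<forall>x\<in>cbox 0 1. f y \<le> f x"
    using continuous_attains_inf[OF compact_cbox, of "0::real ^ 'n" 1 f] box cont
      continuous_on_subset by blast
  then have "f y \<le> f x" for x using box red by metis
  then show thesis using that by blast
qed

section \<open>Subsolutions along a line of zeros of the potential\<close>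

text \<open>As the potential vanishes on the line, the trace of \<open>u\<close> there is a
  subsolution of the one-dimensional equation, tested by \<open>h\<close>; the strict inequalities
  \<open>less\<close> force an interior maximum.\<close>

lemma subsolution_on_zero_line:
  fixes u :: "real ^ 'n \<Rightarrow> real" and e z p :: "real ^ 'n"
  assumes sub: "viscosity_subsolution (\<lambda>y q. mechanical_hamiltonian V y (p + q)) c u"
    and V: "continuous_on UNIV V" "\<And>t. V (z + t *\<^sub>R e) = 0"
    and e: "norm e = 1"
    and h: "\<And>t. (h has_real_derivative h' t) (at t)" "continuous_on UNIV h'"
    and ab: "a < m" "m < b"
    and less: "u (z + a *\<^sub>R e) - h a < u (z + m *\<^sub>R e) - h m"
      "u (z + b *\<^sub>R e) - h b < u (z + m *\<^sub>R e) - h m"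
  obtains t where "a \<le> t" "t \<le> b" "(p \<bullet> e + h' t)\<^sup>2 / 2 \<le> c"
proof -
  \<comment> \<open>Maximise \<open>u y - k (dist y line)\<^sup>2 - h (P y)\<close>, where \<open>P\<close> is the coordinate along the line, and let \<open>k\<close>
    tend to infinity: the maximisers approach the line.\<close>
  define P where "P y = (y - z) \<bullet> e" for y
  define Q where "Q y = y - z - P y *\<^sub>R e" for y
  define f where "f t = u (z + t *\<^sub>R e) - h t" for t
  define D where "D = {y. a \<le> P y \<and> P y \<le> b \<and> norm (Q y) \<le> 1}"
  define \<phi> where "\<phi> k y = real k * (norm (Q y))\<^sup>2 + h (P y)" for k y
  define q where "q k y = (2 * real k) *\<^sub>R Q y + h' (P y) *\<^sub>R e" for k y
  have ee [simp]: "e \<bullet> e = 1" using e by (simp add: norm_eq_1)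
  have u: "continuous_on UNIV u" using sub by (simp add: viscosity_subsolution_def)
  have h_cont: "continuous_on UNIV h"
    using h(1) by (meson DERIV_continuous_on has_field_derivative_at_within)
  have P_line [simp]: "P (z + t *\<^sub>R e) = t" and Q_line [simp]: "Q (z + t *\<^sub>R e) = 0" for t
    by (simp_all add: P_def Q_def)
  have decomp: "y = z + P y *\<^sub>R e + Q y" for y by (simp add: Q_def)
  have Qe: "Q y \<bullet> e = 0" "e \<bullet> Q y = 0" for y
    by (simp_all add: Q_def P_def inner_diff inner_commute)
  have P_cont: "continuous_on A P" for A unfolding P_def[abs_def] by (intro continuous_intros)
  have Q_cont: "continuous_on A Q" for A
    unfolding Q_def[abs_def] by (intro continuous_intros P_cont)
  have hP_cont: "continuous_on A (\<lambda>y. h (P y))" for A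
    using continuous_on_compose2[OF h_cont P_cont[of A]] by simp
  have h'P_cont: "continuous_on A (\<lambda>y. h' (P y))" for A
    using continuous_on_compose2[OF h(2) P_cont[of A]] by simp
  have \<phi>_cont: "continuous_on A (\<phi> k)" for k A
    unfolding \<phi>_def[abs_def] by (intro continuous_intros hP_cont Q_cont)
  have q_cont: "continuous_on A (q k)" for k A
    unfolding q_def[abs_def] by (intro continuous_intros h'P_cont Q_cont)
  have grad: "GDERIV (\<phi> k) y :> q k y" for k y
  proof -
    have "GDERIV P y :> e"
      unfolding P_def[abs_def] gderiv_def by (auto intro!: derivative_eq_intros)
    then have 1: "GDERIV (\<lambda>y. h (P y)) y :> h' (P y) *\<^sub>R e"
      using h(1) by (rule GDERIV_DERIV_compose)
    have "((\<lambda>y. (norm (Q y))\<^sup>2) has_derivative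
        (\<lambda>x. 2 * (Q y \<bullet> (x - (x \<bullet> e) *\<^sub>R e)))) (at y)"
      unfolding power2_norm_eq_inner Q_def[abs_def] P_def[abs_def]
      by (rule derivative_eq_intros refl | simp add: inner_commute)+
    then have 2: "GDERIV (\<lambda>y. (norm (Q y))\<^sup>2) y :> 2 *\<^sub>R Q y"
      unfolding gderiv_def by (simp add: inner_diff_right Qe inner_commute)
    have "GDERIV (\<lambda>y. real k * (norm (Q y))\<^sup>2) y :> (2 * real k) *\<^sub>R Q y"
      using GDERIV_mult[OF GDERIV_const 2, of "real k"] by (simp add: mult.commute)
    then show ?thesis
      using GDERIV_add[OF _ 1] by (simp add: \<phi>_def[abs_def] q_def)
  qed
  have C1: "C_k 1 (\<phi> k)" for k using grad q_cont by (rule C_1_I)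
  have "compact D"
  proof -
    have "closed D"
      unfolding D_def
      by (intro closed_Collect_conj closed_Collect_le continuous_intros P_cont Q_cont)
    moreover have "norm y \<le> norm z + (\<bar>a\<bar> + \<bar>b\<bar>) + 1" if "y \<in> D" for y
    proof -
      have "norm y \<le> norm z + norm (P y *\<^sub>R e) + norm (Q y)"
        using decomp[of y] norm_triangle_ineq norm_triangle_le by (metis add_right_mono)
      moreover have "norm (P y *\<^sub>R e) \<le> \<bar>a\<bar> + \<bar>b\<bar>" using that e by (auto simp: D_def)
      ultimately show ?thesis using that by (simp add: D_def)
    qed
    ultimately show ?thesis by (auto simp: compact_eq_bounded_closed bounded_iff)
  qed
  have mD: "z + m *\<^sub>R e \<in> D" using ab by (simp add: D_def)
  have "\<exists>y\<in>D. \<forall>x\<in>D. u x - \<phi> k x \<le> u y - \<phi> k y" for k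
    using mD by (intro continuous_attains_sup[OF \<open>compact D\<close>] continuous_intros \<phi>_cont
        continuous_on_subset[OF u]) auto
  then obtain Y where Y: "\<And>k. Y k \<in> D" "\<And>k x. x \<in> D \<Longrightarrow> u x - \<phi> k x \<le> u (Y k) - \<phi> k (Y k)"
    by metis
  obtain w r where w: "w \<in> D" "strict_mono r" "(Y \<circ> r) \<longlonglongrightarrow> w"
    using \<open>compact D\<close> Y(1) unfolding compact_def by blast
  let ?Y = "\<lambda>n. Y (r n)"
  have lim: "(\<lambda>n. g (?Y n)) \<longlonglongrightarrow> g w" if "continuous_on UNIV g"
    for g :: "real ^ 'n \<Rightarrow> 'b::topological_space"
    using continuous_on_tendsto_compose[OF that w(3)] by (simp add: o_def)
  have below: "f m \<le> u (Y k) - \<phi> k (Y k)" for k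
    using Y(2)[OF mD, of k] by (simp add: f_def \<phi>_def)
  have below': "f m \<le> u (Y k) - h (P (Y k))" for k
  proof -
    have "0 \<le> real k * (norm (Q (Y k)))\<^sup>2" by simp
    then show ?thesis using below[of k] unfolding \<phi>_def by linarith
  qed
  have diff: "continuous_on UNIV (\<lambda>y. u y - h (P y))"
    by (intro continuous_intros hP_cont u)
  have "f m \<le> u w - h (P w)"
    using lim[OF diff] below' by (intro LIMSEQ_le_const) auto
  \<comment> \<open>If \<open>w\<close> were off the line, the penalty would tend to infinity along
    the subsequence, against the lower bound \<open>below\<close>.\<close>
  moreover have "Q w = 0"
  proof (rule ccontr)
    assume "Q w \<noteq> 0"
    have inf: "filterlim (\<lambda>n. (norm (Q (?Y n)))\<^sup>2 * real (r n)) at_top sequentially"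
    proof (rule filterlim_tendsto_pos_mult_at_top)
      show "(\<lambda>n. (norm (Q (?Y n)))\<^sup>2) \<longlonglongrightarrow> (norm (Q w))\<^sup>2"
        by (intro lim continuous_intros Q_cont)
      show "0 < (norm (Q w))\<^sup>2" using \<open>Q w \<noteq> 0\<close> by simp
      show "filterlim (\<lambda>n. real (r n)) at_top sequentially"
        using filterlim_compose[OF filterlim_real_sequentially filterlim_subseq[OF w(2)]] .
    qed
    have "(\<lambda>n. u (?Y n) - h (P (?Y n))) \<longlonglongrightarrow> u w - h (P w)" by (rule lim[OF diff])
    then have ev1: "\<forall>\<^sub>F n in sequentially. u (?Y n) - h (P (?Y n)) < u w - h (P w) + 1"
      by (rule order_tendstoD) simp
    have ev2: "\<forall>\<^sub>F n in sequentially. u w - h (P w) + 1 - f m \<le> (norm (Q (?Y n)))\<^sup>2 * real (r n)"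
      using inf by (simp add: filterlim_at_top)
    obtain n where "u (?Y n) - h (P (?Y n)) < u w - h (P w) + 1"
      "u w - h (P w) + 1 - f m \<le> (norm (Q (?Y n)))\<^sup>2 * real (r n)"
      using eventually_conj[OF ev1 ev2] by (auto simp: eventually_sequentially)
    then show False using below[of "r n"] by (simp add: \<phi>_def algebra_simps)
  qed
  ultimately have fPw: "f m \<le> f (P w)" and w_eq: "w = z + P w *\<^sub>R e"
    using decomp[of w] by (simp_all add: f_def)
  \<comment> \<open>\<open>less\<close> excludes the ends of the segment, so late maximisers are
    interior to \<open>D\<close> and hence local maxima.\<close>
  have Pw: "a < P w" "P w < b"
    using fPw less w(1) by (auto simp: f_def D_def order_less_le)
  have "\<forall>\<^sub>F n in sequentially. a < P (?Y n) \<and> P (?Y n) < b \<and> norm (Q (?Y n)) < 1"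
  proof (intro eventually_conj)
    show "\<forall>\<^sub>F n in sequentially. a < P (?Y n)" "\<forall>\<^sub>F n in sequentially. P (?Y n) < b"
      using order_tendstoD[OF lim[OF P_cont]] Pw by auto
    show "\<forall>\<^sub>F n in sequentially. norm (Q (?Y n)) < 1"
      using order_tendstoD(2)[OF lim[OF continuous_on_norm[OF Q_cont]]] \<open>Q w = 0\<close> by simp
  qed
  then have "\<forall>\<^sub>F n in sequentially. (p \<bullet> e + h' (P (?Y n)))\<^sup>2 / 2 + V (?Y n) \<le> c"
  proof eventually_elim
    case (elim n)
    let ?S = "{y. a < P y \<and> P y < b \<and> norm (Q y) < 1}"
    have "open ?S"
      by (intro open_Collect_conj open_Collect_less continuous_intros P_cont Q_cont)
    then have "\<forall>\<^sub>F x in nhds (?Y n). x \<in> ?S" using elim by (intro eventually_nhds_in_open) auto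
    then have "\<forall>\<^sub>F x in nhds (?Y n). u x - \<phi> (r n) x \<le> u (?Y n) - \<phi> (r n) (?Y n)"
      by eventually_elim (rule Y(2), simp add: D_def)
    then have "mechanical_hamiltonian V (?Y n) (p + q (r n) (?Y n)) \<le> c"
      using sub C1 grad unfolding viscosity_subsolution_def by blast
    \<comment> \<open>Projection onto \<open>e\<close> removes the penalty part of the gradient,
      whose size is not controlled; what remains converges.\<close>
    moreover have "((p + q (r n) (?Y n)) \<bullet> e)\<^sup>2 \<le> (norm (p + q (r n) (?Y n)))\<^sup>2"
      using Cauchy_Schwarz_ineq2[of "p + q (r n) (?Y n)" e] e
      by (simp add: abs_le_square_iff[symmetric])
    moreover have "(p + q (r n) (?Y n)) \<bullet> e = p \<bullet> e + h' (P (?Y n))"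
      by (simp add: q_def inner_add_left Qe)
    ultimately show ?case by (simp add: mechanical_hamiltonian_def)
  qed
  moreover have "(\<lambda>n. (p \<bullet> e + h' (P (?Y n)))\<^sup>2 / 2 + V (?Y n))
      \<longlonglongrightarrow> (p \<bullet> e + h' (P w))\<^sup>2 / 2 + V w"
    by (intro lim continuous_intros h'P_cont V) simp
  ultimately have "(p \<bullet> e + h' (P w))\<^sup>2 / 2 + V w \<le> c"
    by (intro tendsto_upperbound) auto
  moreover have "V w = 0" using V(2) w_eq by metis
  ultimately show thesis using that[of "P w"] Pw by auto
qed

text \<open>Subtracting \<open>\<kappa> * t\<^sup>2 / 2\<close> makes the middle one of the equal
  values at -1, 0, 1 strictly largest, and the slope on [-1, 1] is at least
  \<open>- \<kappa>\<close>; then \<open>\<kappa>\<close> tends to 0.\<close>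

lemma subsolution_level_ge:
  fixes u :: "real ^ 'n \<Rightarrow> real" and e z p :: "real ^ 'n"
  assumes sub: "viscosity_subsolution (\<lambda>y q. mechanical_hamiltonian V y (p + q)) c u"
    and V: "continuous_on UNIV V" "\<And>t. V (z + t *\<^sub>R e) = 0"
    and e: "norm e = 1"
    and per: "u (z + e) = u z" "u (z - e) = u z"
    and pos: "0 \<le> p \<bullet> e"
  shows "(p \<bullet> e)\<^sup>2 / 2 \<le> c"
proof -
  \<comment> \<open>The truncation at 0 keeps squaring monotone when \<open>\<kappa>\<close> exceeds
    \<open>p \<bullet> e\<close>.\<close>
  have ev: "\<forall>\<^sub>F \<kappa> in at_right 0. (max 0 (p \<bullet> e - \<kappa>))\<^sup>2 / 2 \<le> c"
    unfolding eventually_at_filter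
  proof (rule always_eventually, intro allI impI)
    fix \<kappa> :: real assume "\<kappa> \<in> {0<..}"
    then have \<kappa>: "0 < \<kappa>" by simp
    obtain t where t: "-1 \<le> t" "t \<le> 1" "(p \<bullet> e + \<kappa> * t)\<^sup>2 / 2 \<le> c"
    proof (rule subsolution_on_zero_line[OF sub V e, of "\<lambda>t. \<kappa> * t\<^sup>2 / 2" "\<lambda>t. \<kappa> * t" "-1" 0 1])
      show "((\<lambda>t. \<kappa> * t\<^sup>2 / 2) has_real_derivative \<kappa> * t) (at t)" for t
        by (auto intro!: derivative_eq_intros)
    qed (use per \<kappa> in \<open>auto intro!: continuous_intros\<close>)
    have "\<kappa> * (-1) \<le> \<kappa> * t" using t \<kappa> by (intro mult_left_mono) auto
    then have "(max 0 (p \<bullet> e - \<kappa>))\<^sup>2 \<le> (p \<bullet> e + \<kappa> * t)\<^sup>2"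
      by (cases "p \<bullet> e \<le> \<kappa>") (auto simp: max_def intro!: power_mono)
    then show "(max 0 (p \<bullet> e - \<kappa>))\<^sup>2 / 2 \<le> c" using t(3) by simp
  qed
  have "((\<lambda>\<kappa>. (max 0 (p \<bullet> e - \<kappa>))\<^sup>2 / 2) \<longlongrightarrow> (max 0 (p \<bullet> e - 0))\<^sup>2 / 2) (at_right 0)"
    by (intro tendsto_intros) simp
  then have "(max 0 (p \<bullet> e - 0))\<^sup>2 / 2 \<le> c"
    using ev by (rule tendsto_upperbound) simp
  then show ?thesis using pos by simp
qed

text \<open>At the minimal level, \<open>u\<close> is nonincreasing along the line, hence constant by periodicity.\<close>

lemma subsolution_constant_on_line:
  fixes u :: "real ^ 'n \<Rightarrow> real" and e z p :: "real ^ 'n"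
  assumes sub: "viscosity_subsolution (\<lambda>y q. mechanical_hamiltonian V y (p + q)) ((p \<bullet> e)\<^sup>2 / 2) u"
    and V: "continuous_on UNIV V" "\<And>t. V (z + t *\<^sub>R e) = 0"
    and e: "norm e = 1"
    and per: "\<And>y. u (y + e) = u y"
    and pos: "0 \<le> p \<bullet> e"
  shows "u (z + t *\<^sub>R e) = u z"
proof -
  define f where "f t = u (z + t *\<^sub>R e)" for t
  have per1: "f (t + 1) = f t" for t
    using per[of "z + t *\<^sub>R e"] by (simp add: f_def algebra_simps)
  have le: "f m \<le> f a" if m: "a < m" "m < a + 1" for a m
  proof (rule ccontr)
    assume gt: "\<not> f m \<le> f a"
    \<comment> \<open>With half the supposed increase as slope, \<open>f t - s * t\<close> is larger
      at \<open>m\<close> than at \<open>a\<close> and \<open>a + 1\<close>. The line lemma then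
      contradicts \<open>0 \<le> p \<bullet> e\<close> and \<open>0 < s\<close>.\<close>
    define s where "s = (f m - f a) / 2"
    have s: "0 < s" using gt by (simp add: s_def)
    have fm: "f m = f a + 2 * s" by (simp add: s_def field_simps)
    have "s * m < s * (a + 1)" using m s by simp
    then have "s * m - s * a < f m - f a" using s fm by (simp add: algebra_simps)
    moreover have "s * m < s * (a + 1)" using m s by simp
    ultimately obtain t where "(p \<bullet> e + s)\<^sup>2 / 2 \<le> (p \<bullet> e)\<^sup>2 / 2"
      using subsolution_on_zero_line[OF sub V e, of "\<lambda>t. s * t" "\<lambda>t. s" a m "a + 1"] m s
        per1[of a, unfolded f_def]
      by (force intro!: derivative_eq_intros simp: f_def algebra_simps)
    moreover have "(p \<bullet> e)\<^sup>2 < (p \<bullet> e + s)\<^sup>2"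
      using pos s by (intro power_strict_mono) auto
    ultimately show False by simp
  qed
  \<comment> \<open>Monotonicity on both sides of \<open>s\<close> closes up because
    \<open>f (a + 1) = f a\<close>.\<close>
  have eq: "f s = f a" if "a \<le> s" "s \<le> a + 1" for s a
  proof (cases "s = a \<or> s = a + 1")
    case False
    then have "f s \<le> f a" "f (a + 1) \<le> f s"
      using le[of a s] le[of s "a + 1"] that by auto
    then show ?thesis using per1[of a] by simp
  qed (use per1 in auto)
  have nat: "f (t + real n) = f t" for n t
  proof (induction n)
    case (Suc n)
    then show ?case using per1[of "t + real n"] by (simp add: algebra_simps)
  qed simp
  \<comment> \<open>Only natural shifts are available so far, so \<open>t\<close> is first moved to
    a nonnegative point.\<close>
  obtain n where n: "\<bar>t\<bar> < real n" using reals_Archimedean2 by blast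
  define x where "x = t + real n"
  have "f t = f x" by (simp add: x_def nat)
  also have "f x = f (frac x + real (nat \<lfloor>x\<rfloor>))"
  proof -
    have "0 \<le> x" using n by (simp add: x_def)
    then show ?thesis by (simp add: frac_def)
  qed
  also have "\<dots> = f (frac x)" by (rule nat)
  also have "\<dots> = f 0" using frac_ge_0 frac_lt_1[of x] by (intro eq) auto
  finally show ?thesis by (simp add: f_def)
qed

section \<open>The barrier\<close>

text \<open>The full preimage of the line parallel to axis \<open>i\<close>.\<close>

definition zero_line :: "3 \<Rightarrow> (real ^ 3) set" where
  "zero_line i = {y. y $ (i + 1) - 1 / 2 \<in> \<int> \<and> y $ (i + 2) \<in> \<int>}"

text \<open>All coordinates are 0 or 1/2, so the sine factor of every barrier vanishes here; the gap
  between lines is measured at these points.\<close>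

definition line_base :: "3 \<Rightarrow> real ^ 3" where
  "line_base i = axis (i + 1) (1 / 2)"

text \<open>The index type \<open>3\<close> has arithmetic modulo 3, and \<open>i \<mapsto> i + 1\<close> permutes the lines \<open>L\<^sub>1, L\<^sub>2, L\<^sub>3\<close> cyclically
  (with \<open>3 = 0\<close>).\<close>

lemma index_3_simps [simp]:
  fixes i :: 3
  shows "i + 1 + 1 = i + 2" "i + 1 + 2 = i" "i + 2 + 1 = i" "i + 2 + 2 = i + 1"
    "i + 1 \<noteq> i" "i + 2 \<noteq> i" "i \<noteq> i + 1" "i \<noteq> i + 2" "i + 1 \<noteq> i + 2" "i + 2 \<noteq> i + 1"
  by (simp_all add: add.assoc)

lemma index_3_cases:
  fixes i j :: 3
  obtains "j = i" | "j = i + 1" | "j = i + 2"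
  using exhaust_3[of i] exhaust_3[of j] by fastforce

lemma numeral_index_3: "(4 :: 3) = 1" "(5 :: 3) = 2"
  by simp_all

lemma torus_preimage_lines: "torus_preimage (L1 \<union> L2 \<union> L3) = (\<Union>i. zero_line i)"
proof (intro equalityI subsetI)
  fix y assume "y \<in> torus_preimage (L1 \<union> L2 \<union> L3)"
  then obtain a k where ak: "y = a + k" "a \<in> L1 \<union> L2 \<union> L3" "k \<in> integer_lattice"
    by (auto simp: torus_preimage_def)
  have k: "k $ j \<in> \<int>" for j using ak(3) by (simp add: integer_lattice_def)
  from ak(2) consider "a \<in> L1" | "a \<in> L2" | "a \<in> L3" by blast
  then have "y \<in> zero_line 1 \<or> y \<in> zero_line 2 \<or> y \<in> zero_line 3"
    by cases (auto simp: L1_def L2_def L3_def zero_line_def ak(1) k vector_3 numeral_index_3)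
  then show "y \<in> (\<Union>i. zero_line i)" by blast
next
  fix y assume "y \<in> (\<Union>i. zero_line i)"
  then obtain i where i: "y \<in> zero_line i" by blast
  \<comment> \<open>The representative on the segment: the running coordinate is reduced modulo 1,
    the other two get their exact values.\<close>
  define a :: "real ^ 3" where "a = line_base i + axis i (frac (y $ i))"
  have a: "a $ i = frac (y $ i)" "a $ (i + 1) = 1 / 2" "a $ (i + 2) = 0"
    by (simp_all add: a_def line_base_def axis_def)
  have "(y - a) $ j \<in> \<int>" for j
    using i by (cases rule: index_3_cases[of j i]) (simp_all add: a zero_line_def frac_def)
  then have "y - a \<in> integer_lattice" by (simp add: integer_lattice_def)
  moreover have "a \<in> L1 \<union> L2 \<union> L3"
  proof -
    have bounds: "0 \<le> frac (y $ i)" "frac (y $ i) \<le> 1"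
      by (simp_all add: less_imp_le[OF frac_lt_1])
    consider "i = 1" | "i = 2" | "i = 3" using exhaust_3 by blast
    then show ?thesis
    proof cases
      case 1
      then have "a = vector [frac (y $ i), 1 / 2, 0]"
        using a by (simp add: vec_eq_iff forall_3 vector_3 numeral_index_3)
      then show ?thesis using bounds by (auto simp: L1_def)
    next
      case 2
      then have "a = vector [0, frac (y $ i), 1 / 2]"
        using a by (simp add: vec_eq_iff forall_3 vector_3 numeral_index_3)
      then show ?thesis using bounds by (auto simp: L2_def)
    next
      case 3
      then have "a = vector [1 / 2, 0, frac (y $ i)]"
        using a by (simp add: vec_eq_iff forall_3 vector_3 numeral_index_3)
      then show ?thesis using bounds by (auto simp: L3_def)
    qed
  qed
  moreover have "y = a + (y - a)" by simp
  ultimately show "y \<in> torus_preimage (L1 \<union> L2 \<union> L3)"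
    unfolding torus_preimage_def by blast
qed

text \<open>This is \<open>cos\<^sup>2 (\<pi> y\<^sub>i\<^sub>+\<^sub>1) + sin\<^sup>2 (\<pi> y\<^sub>i\<^sub>+\<^sub>2)\<close>.\<close>

definition line_defect :: "3 \<Rightarrow> real ^ 3 \<Rightarrow> real" where
  "line_defect i y = 1 + (cos (2 * pi * y $ (i + 1)) - cos (2 * pi * y $ (i + 2))) / 2"

definition line_defect_grad :: "3 \<Rightarrow> real ^ 3 \<Rightarrow> real ^ 3" where
  "line_defect_grad i y =
     (pi * sin (2 * pi * y $ (i + 2))) *\<^sub>R axis (i + 2) 1
     - (pi * sin (2 * pi * y $ (i + 1))) *\<^sub>R axis (i + 1) 1"

text \<open>The argument is 2 at defect 1/4 and 0 at defect 1/2. Cutoffs of different lines are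
  never both nonzero, since two defects sum to at least 1.\<close>

definition cutoff :: "3 \<Rightarrow> real ^ 3 \<Rightarrow> real" where
  "cutoff i y = smooth_step (4 - 8 * line_defect i y)"

definition cutoff_grad :: "3 \<Rightarrow> real ^ 3 \<Rightarrow> real ^ 3" where
  "cutoff_grad i y = (- 8 * smooth_step_deriv (4 - 8 * line_defect i y)) *\<^sub>R line_defect_grad i y"

text \<open>Near the line \<open>i\<close> the barrier is the constant \<open>- \<delta>\<close>. Near each of the other two lines it is
  \<open>\<plusminus> \<epsilon> sin (2 \<pi> y\<^sub>i) / (2 \<pi>)\<close>, with the sign for which its derivative on that line cancels the momentum \<open>\<epsilon> e\<^sub>i\<close>.\<close>

definition barrier :: "3 \<Rightarrow> real \<Rightarrow> real \<Rightarrow> real ^ 3 \<Rightarrow> real" where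
  "barrier i \<delta> \<epsilon> y =
     \<epsilon> * ((cutoff (i + 2) y - cutoff (i + 1) y) * (sin (2 * pi * y $ i) / (2 * pi)))
     - \<delta> * cutoff i y"

definition barrier_grad :: "3 \<Rightarrow> real \<Rightarrow> real \<Rightarrow> real ^ 3 \<Rightarrow> real ^ 3" where
  "barrier_grad i \<delta> \<epsilon> y =
     \<epsilon> *\<^sub>R (((cutoff (i + 2) y - cutoff (i + 1) y) * cos (2 * pi * y $ i)) *\<^sub>R axis i 1
       + (sin (2 * pi * y $ i) / (2 * pi)) *\<^sub>R (cutoff_grad (i + 2) y - cutoff_grad (i + 1) y))
     - \<delta> *\<^sub>R cutoff_grad i y"

section \<open>Derivatives, continuity and periodicity of the barrier\<close>

lemma GDERIV_component: "GDERIV (\<lambda>y. y $ j) (y :: real ^ 'n) :> axis j 1"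
  unfolding gderiv_def
  using bounded_linear_imp_has_derivative[OF bounded_linear_vec_nth] by (simp add: inner_axis)

lemma GDERIV_line_defect: "GDERIV (line_defect i) y :> line_defect_grad i y"
proof -
  have c: "GDERIV (\<lambda>y. cos (2 * pi * y $ j)) y :> (- (2 * pi * sin (2 * pi * y $ j))) *\<^sub>R axis j 1"
    for j :: 3
    by (rule GDERIV_DERIV_compose[OF GDERIV_component, where g = "\<lambda>x. cos (2 * pi * x)"])
      (auto intro!: derivative_eq_intros)
  have "((\<lambda>x. 1 + x / 2) has_real_derivative 1 / 2) (at x)" for x :: real
    by (auto intro!: derivative_eq_intros)
  from GDERIV_DERIV_compose[OF GDERIV_diff[OF c[of "i + 1"] c[of "i + 2"]] this]
  show ?thesis
    unfolding line_defect_def[abs_def]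
    by (rule GDERIV_subst) (simp add: line_defect_grad_def algebra_simps)
qed

lemma GDERIV_cutoff: "GDERIV (cutoff i) y :> cutoff_grad i y"
proof -
  have "((\<lambda>x. 4 - 8 * x) has_real_derivative - 8) (at x)" for x :: real
    by (auto intro!: derivative_eq_intros)
  from DERIV_chain2[OF has_real_derivative_smooth_step this]
  have "((\<lambda>x. smooth_step (4 - 8 * x)) has_real_derivative
      smooth_step_deriv (4 - 8 * x) * - 8) (at x)" for x .
  from GDERIV_DERIV_compose[OF GDERIV_line_defect[of i y] this]
  show ?thesis by (simp add: cutoff_def[abs_def] cutoff_grad_def mult.commute)
qed

lemma GDERIV_barrier: "GDERIV (barrier i \<delta> \<epsilon>) y :> barrier_grad i \<delta> \<epsilon> y"
proof -
  have s: "GDERIV (\<lambda>y. sin (2 * pi * y $ i) / (2 * pi)) y :> cos (2 * pi * y $ i) *\<^sub>R axis i 1"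
    by (rule GDERIV_DERIV_compose[OF GDERIV_component, where g = "\<lambda>x. sin (2 * pi * x) / (2 * pi)"])
      (auto intro!: derivative_eq_intros)
  note 1 = GDERIV_mult[OF GDERIV_diff[OF GDERIV_cutoff[of "i + 2" y] GDERIV_cutoff[of "i + 1" y]] s]
  note 2 = GDERIV_diff[OF GDERIV_mult[OF GDERIV_const 1, of \<epsilon>]
      GDERIV_mult[OF GDERIV_const GDERIV_cutoff, of \<delta> i]]
  show ?thesis
    unfolding barrier_def[abs_def]
    by (rule GDERIV_subst[OF 2]) (simp add: barrier_grad_def)
qed

lemma continuous_on_barrier_grad: "continuous_on A (barrier_grad i \<delta> \<epsilon>)"
proof -
  have cont: "continuous_on A (line_defect j)" for j :: 3
    unfolding line_defect_def[abs_def] by (intro continuous_intros) auto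
  have "continuous_on A (cutoff j)" for j
    using GDERIV_cutoff by (rule GDERIV_imp_continuous_on)
  moreover have "continuous_on A (cutoff_grad j)" for j
    unfolding cutoff_grad_def[abs_def] line_defect_grad_def[abs_def]
    by (intro continuous_intros cont continuous_on_compose2[OF continuous_on_smooth_step_deriv]) auto
  ultimately show ?thesis
    unfolding barrier_grad_def[abs_def] by (intro continuous_intros) auto
qed

lemma lattice_periodic_line_defect: "lattice_periodic (line_defect i)"
proof -
  have "cos (2 * pi * (x + n)) = cos (2 * pi * x)" if "n \<in> \<int>" for x n :: real
  proof -
    have "cos (2 * pi * n) = 1" "sin (2 * pi * n) = 0"
      using that by (auto elim!: Ints_cases)
    then show ?thesis by (simp add: distrib_left cos_add)
  qed
  then show ?thesis by (simp add: lattice_periodic_def line_defect_def integer_lattice_def)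
qed

lemma lattice_periodic_barrier: "lattice_periodic (barrier i \<delta> \<epsilon>)"
proof -
  have "sin (2 * pi * (x + n)) = sin (2 * pi * x)" if "n \<in> \<int>" for x n :: real
  proof -
    have "cos (2 * pi * n) = 1" "sin (2 * pi * n) = 0"
      using that by (auto elim!: Ints_cases)
    then show ?thesis by (simp add: distrib_left sin_add)
  qed
  then show ?thesis
    using lattice_periodic_line_defect
    by (simp add: lattice_periodic_def barrier_def cutoff_def integer_lattice_def)
qed

section \<open>Separation of the three lines\<close>

lemma line_defect_eq_0_iff: "line_defect i y = 0 \<longleftrightarrow> y \<in> zero_line i"
proof -
  have one: "cos (2 * pi * x) = 1 \<longleftrightarrow> x \<in> \<int>" for x :: real
    by (auto simp: cos_one_2pi_int Ints_def)
  have minus_one: "cos (2 * pi * x) = -1 \<longleftrightarrow> x - 1 / 2 \<in> \<int>" for x :: real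
  proof -
    have "cos (2 * pi * (x - 1 / 2)) = - cos (2 * pi * x)"
      by (simp add: right_diff_distrib cos_diff)
    then show ?thesis using one[of "x - 1 / 2"] by auto
  qed
  \<comment> \<open>The defect vanishes only if both cosines are extremal.\<close>
  have "1 + (a - b) / 2 = 0 \<longleftrightarrow> a = -1 \<and> b = 1" if "-1 \<le> a" "b \<le> 1" for a b :: real
    using that by argo
  then have "line_defect i y = 0 \<longleftrightarrow> cos (2 * pi * y $ (i + 1)) = -1 \<and> cos (2 * pi * y $ (i + 2)) = 1"
    unfolding line_defect_def using cos_ge_minus_one cos_le_one by blast
  then show ?thesis by (simp add: one minus_one zero_line_def)
qed

text \<open>In the sum the cosine of the coordinate common to both defects cancels, leaving 2 plus
  half a difference of two cosines.\<close>

lemma line_defect_disjoint: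
  assumes "j \<noteq> i"
  shows "1 \<le> line_defect i y + line_defect j y"
proof -
  have bounds: "-1 \<le> cos (2 * pi * y $ k)" "cos (2 * pi * y $ k) \<le> 1" for k by auto
  consider "j = i + 1" | "j = i + 2" using assms index_3_cases by metis
  then show ?thesis
  proof cases
    case 1
    then have "line_defect j y = 1 + (cos (2 * pi * y $ (i + 2)) - cos (2 * pi * y $ i)) / 2"
      by (simp add: line_defect_def)
    then show ?thesis
      using bounds(1)[of "i + 1"] bounds(2)[of i] unfolding line_defect_def[of i] by argo
  next
    case 2
    then have "line_defect j y = 1 + (cos (2 * pi * y $ i) - cos (2 * pi * y $ (i + 1))) / 2"
      by (simp add: line_defect_def)
    then show ?thesis
      using bounds(2)[of "i + 2"] bounds(1)[of i] unfolding line_defect_def[of i] by argo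
  qed
qed

section \<open>Values and gradient bounds of the barrier\<close>

lemma cutoff_near:
  assumes "line_defect i y \<le> 1 / 4"
  shows "cutoff i y = 1" "cutoff_grad i y = 0"
  using assms by (simp_all add: cutoff_def cutoff_grad_def smooth_step_flat)

lemma cutoff_far:
  assumes "1 / 2 \<le> line_defect i y"
  shows "cutoff i y = 0" "cutoff_grad i y = 0"
  using assms by (simp_all add: cutoff_def cutoff_grad_def smooth_step_flat)

lemma cutoff_near_other:
  assumes "line_defect i y \<le> 1 / 4" "j \<noteq> i"
  shows "cutoff j y = 0" "cutoff_grad j y = 0"
  using assms line_defect_disjoint[of j i y] by (auto intro!: cutoff_far)

lemma barrier_zero_line:
  assumes "y \<in> zero_line i"
  shows "barrier i \<delta> \<epsilon> y = - \<delta>"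
  using assms cutoff_near[of i y] cutoff_near_other[of i y]
  by (simp add: barrier_def line_defect_eq_0_iff[symmetric])

lemma barrier_line_base:
  assumes "j \<noteq> i"
  shows "barrier i \<delta> \<epsilon> (line_base j) = 0"
proof -
  have "line_defect j (line_base j) = 0"
    by (simp add: line_defect_eq_0_iff zero_line_def line_base_def axis_def)
  moreover have "sin (2 * pi * line_base j $ i) = 0"
    by (simp add: line_base_def axis_def)
  ultimately show ?thesis
    using assms cutoff_near_other[of j "line_base j" i] by (simp add: barrier_def)
qed

lemma norm_cutoff_grad_le: "norm (cutoff_grad i y) \<le> 16 * pi"
proof -
  have "norm (line_defect_grad i y) \<le> norm ((pi * sin (2 * pi * y $ (i + 2))) *\<^sub>R axis (i + 2) (1::real))
      + norm ((pi * sin (2 * pi * y $ (i + 1))) *\<^sub>R axis (i + 1) (1::real))"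
    unfolding line_defect_grad_def by (rule norm_triangle_ineq4)
  also have "\<dots> = pi * \<bar>sin (2 * pi * y $ (i + 2))\<bar> + pi * \<bar>sin (2 * pi * y $ (i + 1))\<bar>"
    by (simp add: abs_mult)
  also have "\<dots> \<le> pi * 1 + pi * 1"
    by (intro add_mono mult_left_mono) auto
  finally have "norm (line_defect_grad i y) \<le> 2 * pi" by simp
  then have "\<bar>smooth_step_deriv (4 - 8 * line_defect i y)\<bar> * norm (line_defect_grad i y) \<le> 1 * (2 * pi)"
    by (intro mult_mono smooth_step_deriv_bounds) auto
  then show ?thesis by (simp add: cutoff_grad_def abs_mult mult.commute)
qed

text \<open>The 17 is 1 from the derivative of the sine plus 16 from the two cutoff gradients,
  \<open>32 * pi\<close> in total, times the amplitude \<open>1 / (2 * pi)\<close>.\<close>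

lemma norm_barrier_grad_le:
  assumes "0 \<le> \<delta>" "0 \<le> \<epsilon>"
  shows "norm (barrier_grad i \<delta> \<epsilon> y) \<le> 17 * \<epsilon> + 16 * pi * \<delta>"
proof -
  let ?a = "((cutoff (i + 2) y - cutoff (i + 1) y) * cos (2 * pi * y $ i)) *\<^sub>R axis i (1::real) :: real ^ 3"
  let ?b = "(sin (2 * pi * y $ i) / (2 * pi)) *\<^sub>R (cutoff_grad (i + 2) y - cutoff_grad (i + 1) y)"
  have "\<bar>cutoff (i + 2) y - cutoff (i + 1) y\<bar> \<le> 1"
    unfolding cutoff_def using smooth_step_bounds by (smt (verit))
  then have "\<bar>cutoff (i + 2) y - cutoff (i + 1) y\<bar> * \<bar>cos (2 * pi * y $ i)\<bar> \<le> 1 * 1"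
    by (intro mult_mono) auto
  then have a: "norm ?a \<le> 1" by (simp add: abs_mult)
  have "norm (cutoff_grad (i + 2) y - cutoff_grad (i + 1) y) \<le> 16 * pi + 16 * pi"
    using norm_triangle_ineq4 norm_cutoff_grad_le by (smt (verit))
  then have "\<bar>sin (2 * pi * y $ i)\<bar> / (2 * pi) * norm (cutoff_grad (i + 2) y - cutoff_grad (i + 1) y)
      \<le> 1 / (2 * pi) * (32 * pi)"
    by (intro mult_mono divide_right_mono) auto
  then have b: "norm ?b \<le> 16" by simp
  have "norm (barrier_grad i \<delta> \<epsilon> y) \<le> \<epsilon> * norm (?a + ?b) + \<delta> * norm (cutoff_grad i y)"
    unfolding barrier_grad_def
    using norm_triangle_ineq4[of "\<epsilon> *\<^sub>R (?a + ?b)" "\<delta> *\<^sub>R cutoff_grad i y"] assms by simp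
  also have "\<dots> \<le> \<epsilon> * 17 + \<delta> * (16 * pi)"
    using a b norm_triangle_ineq[of ?a ?b] assms
    by (intro add_mono mult_left_mono norm_cutoff_grad_le) auto
  finally show ?thesis by (simp add: mult_ac)
qed

text \<open>Near line \<open>i\<close> the barrier is flat and \<open>V\<close> is negative off the
  line; near another line the barrier opposes the momentum; elsewhere \<open>V\<close> is below a
  fixed negative constant. The depth \<open>\<eta>\<close> of the barrier is the same for all small
  \<open>\<epsilon>\<close>.\<close>

lemma barrier_hamiltonian:
  assumes per: "lattice_periodic V" and cont: "continuous_on UNIV V" and le: "\<And>y. V y \<le> 0"
    and zero: "\<And>y. V y = 0 \<longleftrightarrow> (\<exists>i. y \<in> zero_line i)"
  obtains \<eta> where "0 < \<eta>"
    "\<And>i \<epsilon> y. 0 < \<epsilon> \<Longrightarrow> \<epsilon> \<le> \<eta> \<Longrightarrow> y \<notin> zero_line i \<Longrightarrow>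
       mechanical_hamiltonian V y (\<epsilon> *\<^sub>R axis i 1 + barrier_grad i \<eta> \<epsilon> y) < \<epsilon>\<^sup>2 / 2"
proof -
  \<comment> \<open>\<open>W\<close> is positive everywhere and equals \<open>- V\<close> wherever all three defects are at least \<open>1 / 4\<close>.\<close>
  define W where "W y = max (- V y) (max (1 / 4 - line_defect 0 y)
    (max (1 / 4 - line_defect (0 + 1) y) (1 / 4 - line_defect (0 + 2) y)))" for y
  have "lattice_periodic W"
    using per lattice_periodic_line_defect unfolding lattice_periodic_def W_def by auto
  moreover have "continuous_on UNIV W"
    unfolding W_def[abs_def] line_defect_def[abs_def] by (intro continuous_intros cont) auto
  ultimately obtain w where w: "\<And>y. W w \<le> W y" using periodic_attains_inf by blast
  define m where "m = W w"
  have "0 < W y" for y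
  proof (cases "V y = 0")
    case True
    then obtain j where j: "line_defect j y = 0" using zero by (auto simp: line_defect_eq_0_iff)
    show ?thesis
      by (cases rule: index_3_cases[of j 0]) (use j in \<open>auto simp: W_def max_def\<close>)
  next
    case False
    then show ?thesis using le[of y] by (simp add: W_def)
  qed
  then have m: "0 < m" by (simp add: m_def)
  have far: "V y \<le> - m" if "\<And>j. 1 / 4 \<le> line_defect j y" for y
    using w[of y] m that[of 0] that[of "0 + 1"] that[of "0 + 2"]
    unfolding m_def W_def[of y] by linarith
  \<comment> \<open>In the last case the momentum is at most
    \<open>18 * \<epsilon> + 16 * pi * \<eta>\<close>, hence at most \<open>82 * \<eta>\<close>; the
    factor 100 keeps half its square below \<open>m\<close>.\<close>
  define \<eta> where "\<eta> = sqrt m / 100"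
  show thesis
  proof (rule that)
    show "0 < \<eta>" using m by (simp add: \<eta>_def)
    fix i \<epsilon> y assume \<epsilon>: "0 < \<epsilon>" "\<epsilon> \<le> \<eta>" and y: "y \<notin> zero_line i"
    let ?q = "barrier_grad i \<eta> \<epsilon> y"
    let ?c = "cos (2 * pi * y $ i)"
    consider "line_defect i y \<le> 1 / 4" | "line_defect (i + 1) y \<le> 1 / 4" | "line_defect (i + 2) y \<le> 1 / 4"
      | "\<And>j. 1 / 4 \<le> line_defect j y"
      by (metis index_3_cases nle_le)
    then show "mechanical_hamiltonian V y (\<epsilon> *\<^sub>R axis i 1 + ?q) < \<epsilon>\<^sup>2 / 2"
    proof cases
      case 1
      have "?q = 0"
        by (simp add: barrier_grad_def cutoff_near[OF 1] cutoff_near_other[OF 1])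
      \<comment> \<open>Line \<open>i\<close> is excluded by \<open>y\<close>, the other two by the
        separation of the defects.\<close>
      moreover have "V y \<noteq> 0"
      proof
        assume "V y = 0"
        then obtain j where "line_defect j y = 0" using zero by (auto simp: line_defect_eq_0_iff)
        moreover have "j \<noteq> i" using calculation y line_defect_eq_0_iff by blast
        ultimately show False using line_defect_disjoint[of j i y] 1 by simp
      qed
      ultimately show ?thesis
        using le[of y] by (simp add: mechanical_hamiltonian_def)
    next
      case 2
      have "?q = (- (\<epsilon> * ?c)) *\<^sub>R axis i 1"
        by (simp add: barrier_grad_def cutoff_near[OF 2] cutoff_near_other[OF 2])
      then have "\<epsilon> *\<^sub>R axis i 1 + ?q = (\<epsilon> * (1 - ?c)) *\<^sub>R axis i 1"
        by (simp add: right_diff_distrib scaleR_left_diff_distrib)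
      then have "norm (\<epsilon> *\<^sub>R axis i 1 + ?q) = \<epsilon> * (1 - ?c)" using \<epsilon> by simp
      \<comment> \<open>Coordinate \<open>i\<close> is integral on line \<open>i + 1\<close>, and
        the defect bound forces its cosine to be at least 1/2, so the gradient cancels part of the
        momentum without overshooting.\<close>
      moreover have "0 < ?c"
        using 2 cos_ge_minus_one[of "2 * pi * y $ (i + 2)"]
        unfolding line_defect_def index_3_simps by argo
      then have "\<epsilon> * (1 - ?c) < \<epsilon>" using \<epsilon> by (simp add: right_diff_distrib)
      moreover have "0 \<le> \<epsilon> * (1 - ?c)" using \<epsilon> by simp
      ultimately have "(norm (\<epsilon> *\<^sub>R axis i 1 + ?q))\<^sup>2 < \<epsilon>\<^sup>2"
        by (intro power_strict_mono) auto
      then show ?thesis using le[of y] by (simp add: mechanical_hamiltonian_def)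
    next
      case 3
      have "?q = (\<epsilon> * ?c) *\<^sub>R axis i 1"
        by (simp add: barrier_grad_def cutoff_near[OF 3] cutoff_near_other[OF 3])
      then have "\<epsilon> *\<^sub>R axis i 1 + ?q = (\<epsilon> * (1 + ?c)) *\<^sub>R axis i 1"
        by (simp add: distrib_left scaleR_left_distrib)
      moreover have "0 \<le> 1 + ?c" using cos_ge_minus_one[of "2 * pi * y $ i"] by linarith
      ultimately have "norm (\<epsilon> *\<^sub>R axis i 1 + ?q) = \<epsilon> * (1 + ?c)" using \<epsilon> by simp
      \<comment> \<open>On line \<open>i + 2\<close> coordinate \<open>i\<close> is a half-integer
        and the cosine is at most -1/2, which is why the barrier has the opposite sign here.\<close>
      moreover have "?c < 0"
        using 3 cos_le_one[of "2 * pi * y $ (i + 1)"]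
        unfolding line_defect_def index_3_simps by argo
      then have "\<epsilon> * (1 + ?c) < \<epsilon>" using \<epsilon> by (simp add: distrib_left mult_pos_neg)
      moreover have "0 \<le> \<epsilon> * (1 + ?c)" using \<epsilon> \<open>0 \<le> 1 + ?c\<close> by simp
      ultimately have "(norm (\<epsilon> *\<^sub>R axis i 1 + ?q))\<^sup>2 < \<epsilon>\<^sup>2"
        by (intro power_strict_mono) auto
      then show ?thesis using le[of y] by (simp add: mechanical_hamiltonian_def)
    next
      case 4
      have "norm (\<epsilon> *\<^sub>R axis i 1 + ?q) \<le> norm (\<epsilon> *\<^sub>R axis i 1 :: real ^ 3) + norm ?q"
        by (rule norm_triangle_ineq)
      also have "\<dots> \<le> \<epsilon> + (17 * \<epsilon> + 16 * pi * \<eta>)"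
        using norm_barrier_grad_le[of \<eta> \<epsilon> i y] \<epsilon> by simp
      also have "\<dots> \<le> 82 * \<eta>"
      proof -
        have "pi * \<eta> \<le> 4 * \<eta>" using \<epsilon> pi_less_4 by (intro mult_right_mono) auto
        then show ?thesis using \<epsilon> by linarith
      qed
      finally have "(norm (\<epsilon> *\<^sub>R axis i 1 + ?q))\<^sup>2 \<le> (82 * \<eta>)\<^sup>2"
        by (intro power_mono) auto
      also have "\<dots> < 2 * m"
        using m by (simp add: \<eta>_def power_mult_distrib power_divide)
      finally have "1 / 2 * (norm (\<epsilon> *\<^sub>R axis i 1 + ?q))\<^sup>2 < m" by simp
      moreover have "0 < \<epsilon>\<^sup>2 / 2" using \<epsilon> by simp
      ultimately show ?thesis
        unfolding mechanical_hamiltonian_def using far[OF 4] by linarith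
    qed
  qed
qed

section \<open>Comparison with the barrier\<close>

lemma C_infinity_imp_continuous: "C_infinity f \<Longrightarrow> continuous_on UNIV f"
  unfolding C_infinity_def by (metis C_k.simps(1))

lemma axis_integer_lattice: "m \<in> \<int> \<Longrightarrow> m *\<^sub>R axis i 1 \<in> integer_lattice"
  by (auto simp: integer_lattice_def axis_def)

text \<open>\<open>u\<close> minus the barrier is minimal on line \<open>i\<close>, where
  \<open>u\<close> is constant, and the barrier is higher by \<open>\<eta>\<close> at the base point
  of line \<open>j\<close>. The level \<open>c\<close> is arbitrary: the argument itself determines
  it.\<close>

lemma solution_gap:
  fixes V :: "real ^ 3 \<Rightarrow> real"
  assumes per: "lattice_periodic V" and cont: "continuous_on UNIV V" and le: "\<And>y. V y \<le> 0"
    and zero: "\<And>y. V y = 0 \<longleftrightarrow> (\<exists>i. y \<in> zero_line i)"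
  obtains \<eta> where "0 < \<eta>"
    "\<And>i j \<epsilon> c u. 0 < \<epsilon> \<Longrightarrow> \<epsilon> \<le> \<eta> \<Longrightarrow> j \<noteq> i \<Longrightarrow>
       cell_solution (mechanical_hamiltonian V) (\<epsilon> *\<^sub>R axis i 1) c u \<Longrightarrow>
       u (line_base i) + \<eta> \<le> u (line_base j)"
proof -
  obtain \<eta> where \<eta>: "0 < \<eta>" and H:
    "\<And>i \<epsilon> y. 0 < \<epsilon> \<Longrightarrow> \<epsilon> \<le> \<eta> \<Longrightarrow> y \<notin> zero_line i \<Longrightarrow>
       mechanical_hamiltonian V y (\<epsilon> *\<^sub>R axis i 1 + barrier_grad i \<eta> \<epsilon> y) < \<epsilon>\<^sup>2 / 2"
    using barrier_hamiltonian[OF per cont le zero] by blast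
  show thesis
  proof (rule that[OF \<eta>])
    fix i j :: 3 and \<epsilon> c u
    assume \<epsilon>: "0 < \<epsilon>" "\<epsilon> \<le> \<eta>" and ij: "j \<noteq> i"
      and sol: "cell_solution (mechanical_hamiltonian V) (\<epsilon> *\<^sub>R axis i 1) c u"
    define e :: "real ^ 3" where "e = axis i 1"
    define p where "p = \<epsilon> *\<^sub>R e"
    define \<phi> where "\<phi> = barrier i \<eta> \<epsilon>"
    have u_per: "lattice_periodic u"
      and sub: "viscosity_subsolution (\<lambda>y q. mechanical_hamiltonian V y (p + q)) c u"
      and super: "viscosity_supersolution (\<lambda>y q. mechanical_hamiltonian V y (p + q)) c u"
      using sol by (auto simp: cell_solution_def viscosity_solution_def p_def e_def)
    have e: "norm e = 1" and pe: "p \<bullet> e = \<epsilon>" by (simp_all add: e_def p_def inner_axis)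
    have u_cont: "continuous_on UNIV u" using sub by (simp add: viscosity_subsolution_def)
    have shift: "u (y + m *\<^sub>R e) = u y" if "m \<in> \<int>" for y m
      using u_per axis_integer_lattice[OF that, of i] by (simp add: lattice_periodic_def e_def)
    have u_e: "u (y + e) = u y" "u (y - e) = u y" for y
      using shift[of 1 y] shift[of "-1" y] by simp_all
    have V_line: "V (line_base i + t *\<^sub>R e) = 0" for t
      unfolding zero by (rule exI[of _ i]) (simp add: zero_line_def line_base_def e_def axis_def)
    have C1: "C_k 1 \<phi>"
      unfolding \<phi>_def using GDERIV_barrier continuous_on_barrier_grad by (rule C_1_I)
    have \<phi>_cont: "continuous_on UNIV \<phi>"
      unfolding \<phi>_def using GDERIV_barrier by (rule GDERIV_imp_continuous_on)
    have diff_per: "lattice_periodic (\<lambda>y. u y - \<phi> y)"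
      using u_per lattice_periodic_barrier[of i \<eta> \<epsilon>] by (simp add: lattice_periodic_def \<phi>_def)
    obtain w where w: "\<And>y. u w - \<phi> w \<le> u y - \<phi> y"
      using periodic_attains_inf[OF diff_per continuous_on_diff[OF u_cont \<phi>_cont]] by metis
    \<comment> \<open>\<open>\<phi>\<close> touches \<open>u\<close> from below at \<open>w\<close>, which bounds the unknown level \<open>c\<close> from above.\<close>
    have c_le: "c \<le> mechanical_hamiltonian V w (p + barrier_grad i \<eta> \<epsilon> w)"
    proof -
      have "GDERIV \<phi> w :> barrier_grad i \<eta> \<epsilon> w" unfolding \<phi>_def by (rule GDERIV_barrier)
      moreover have "\<forall>\<^sub>F y in nhds w. u y - \<phi> y \<ge> u w - \<phi> w" using w by simp
      ultimately show ?thesis using super C1 unfolding viscosity_supersolution_def by blast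
    qed
    have c_ge: "\<epsilon>\<^sup>2 / 2 \<le> c"
      using subsolution_level_ge[OF sub cont V_line e u_e] \<epsilon> pe by simp
    \<comment> \<open>Elsewhere the strict barrier inequality would push \<open>c\<close> below
      \<open>\<epsilon>\<^sup>2 / 2\<close>.\<close>
    have w_line: "w \<in> zero_line i"
      using H[OF \<epsilon>, of w i] c_le c_ge by (force simp: p_def e_def)
    have "barrier_grad i \<eta> \<epsilon> w = 0"
    proof -
      have near: "line_defect i w \<le> 1 / 4" using w_line by (simp flip: line_defect_eq_0_iff)
      show ?thesis by (simp add: barrier_grad_def cutoff_near[OF near] cutoff_near_other[OF near])
    qed
    moreover have "V w = 0" using w_line zero by blast
    \<comment> \<open>This is the least level that line \<open>i\<close> allows, as constancy of
      \<open>u\<close> along it requires.\<close>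
    ultimately have "c = \<epsilon>\<^sup>2 / 2"
      using c_le c_ge e \<epsilon> by (simp add: mechanical_hamiltonian_def p_def)
    then have sub': "viscosity_subsolution (\<lambda>y q. mechanical_hamiltonian V y (p + q)) ((p \<bullet> e)\<^sup>2 / 2) u"
      using sub by (simp only: pe)
    have "u (line_base i + t *\<^sub>R e) = u (line_base i)" for t
      using subsolution_constant_on_line[OF sub' cont V_line e u_e(1)] pe \<epsilon> by simp
    \<comment> \<open>\<open>w\<close> may lie on a lattice translate of the line through the base
      point.\<close>
    moreover have "u (line_base i + (w $ i) *\<^sub>R e) = u w"
    proof -
      let ?k = "w - (line_base i + (w $ i) *\<^sub>R e)"
      have "?k $ m \<in> \<int>" for m
        using w_line by (cases rule: index_3_cases[of m i])
          (simp_all add: zero_line_def line_base_def e_def axis_def)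
      then have "?k \<in> integer_lattice" by (simp add: integer_lattice_def)
      then have "u (line_base i + (w $ i) *\<^sub>R e + ?k) = u (line_base i + (w $ i) *\<^sub>R e)"
        using u_per unfolding lattice_periodic_def by blast
      then show ?thesis by simp
    qed
    ultimately have "u w = u (line_base i)" by metis
    then show "u (line_base i) + \<eta> \<le> u (line_base j)"
      using w[of "line_base j"] barrier_zero_line[OF w_line] barrier_line_base[OF ij]
      by (simp add: \<phi>_def)
  qed
qed

theorem theorem5p4:
  fixes V :: "real ^ 3 \<Rightarrow> real"
  assumes "lattice_periodic V"
    and "C_infinity V"
    and "(\<forall>y. V y \<le> 0) \<and> (\<exists>y. V y = 0)"
    and "{y. V y = 0} = torus_preimage (L1 \<union> L2 \<union> L3)"
  shows "\<not> (\<exists>v :: real ^ 3 \<Rightarrow> real ^ 3 \<Rightarrow> real.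
           (\<forall>p. (\<exists>C. C-lipschitz_on UNIV (\<lambda>y. v y p)) \<and>
                cell_solution (mechanical_hamiltonian V) p
                  (effective_hamiltonian (mechanical_hamiltonian V) p) (\<lambda>y. v y p)) \<and>
           (\<forall>y. isCont (\<lambda>p. v y p) 0))"
proof
  assume "\<exists>v :: real ^ 3 \<Rightarrow> real ^ 3 \<Rightarrow> real.
           (\<forall>p. (\<exists>C. C-lipschitz_on UNIV (\<lambda>y. v y p)) \<and>
                cell_solution (mechanical_hamiltonian V) p
                  (effective_hamiltonian (mechanical_hamiltonian V) p) (\<lambda>y. v y p)) \<and>
           (\<forall>y. isCont (\<lambda>p. v y p) 0)"
  then obtain v :: "real ^ 3 \<Rightarrow> real ^ 3 \<Rightarrow> real" where
    sol: "\<And>p. cell_solution (mechanical_hamiltonian V) p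
        (effective_hamiltonian (mechanical_hamiltonian V) p) (\<lambda>y. v y p)"
    and cont: "\<And>y. isCont (\<lambda>p. v y p) 0"
    by blast
  have zero: "V y = 0 \<longleftrightarrow> (\<exists>i. y \<in> zero_line i)" for y
    using assms(4) unfolding torus_preimage_lines by blast
  obtain \<eta> where \<eta>: "0 < \<eta>" and gap:
    "\<And>i j \<epsilon> c u. 0 < \<epsilon> \<Longrightarrow> \<epsilon> \<le> \<eta> \<Longrightarrow> j \<noteq> i \<Longrightarrow>
       cell_solution (mechanical_hamiltonian V) (\<epsilon> *\<^sub>R axis i 1) c u \<Longrightarrow>
       u (line_base i) + \<eta> \<le> u (line_base j)"
    using solution_gap[OF assms(1) C_infinity_imp_continuous[OF assms(2)] _ zero] assms(3) by blast
  \<comment> \<open>Since \<open>\<eta>\<close> does not depend on \<open>\<epsilon>\<close>, the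
    gap survives as the momentum tends to 0 along axis \<open>i\<close>.\<close>
  have limit: "v (line_base i) 0 + \<eta> \<le> v (line_base j) 0" if "j \<noteq> i" for i j
  proof (rule tendsto_le)
    have "((\<lambda>\<epsilon>. \<epsilon> *\<^sub>R axis i 1) \<longlongrightarrow> (0 :: real ^ 3)) (at_right 0)"
      by (auto intro!: tendsto_eq_intros)
    then have lim: "((\<lambda>\<epsilon>. v y (\<epsilon> *\<^sub>R axis i 1)) \<longlongrightarrow> v y 0) (at_right 0)" for y
      by (rule isCont_tendsto_compose[OF cont])
    show "((\<lambda>\<epsilon>. v (line_base j) (\<epsilon> *\<^sub>R axis i 1)) \<longlongrightarrow> v (line_base j) 0) (at_right 0)"
      by (rule lim)
    show "((\<lambda>\<epsilon>. v (line_base i) (\<epsilon> *\<^sub>R axis i 1) + \<eta>) \<longlongrightarrow> v (line_base i) 0 + \<eta>) (at_right 0)"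
      by (intro tendsto_intros lim)
    show "\<forall>\<^sub>F \<epsilon> in at_right 0. v (line_base i) (\<epsilon> *\<^sub>R axis i 1) + \<eta> \<le> v (line_base j) (\<epsilon> *\<^sub>R axis i 1)"
      using eventually_at_right_less[of 0] eventually_at_right_real[OF \<eta>]
      by eventually_elim (use gap[OF _ _ that sol] in auto)
  qed simp
  \<comment> \<open>Each of two base values would exceed the other by \<open>\<eta>\<close>; index 0
    stands for axis 3.\<close>
  show False
    using limit[of 1 0] limit[of 0 1] \<eta> by simp
qed

end
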